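(* Let $(S,A)$ be a physical model in normal form with $S\subseteq\mathbb{R}^n$ and $A=\{\varpi_1^n,\dots,\varpi_n^n\}$, and let $(R,H)$ be a basic representation of $(S,A)$ in a $T_1$ effective topology $(\mathcal{B},\nu)=(\mathcal{B}_1,\nu_1)\otimes(\mathcal{B}_2,\nu_2)\otimes\cdots\otimes(\mathcal{B}_n,\nu_n)$. Let $k\le n$ and let $\phi_1,\dots,\phi_k$ be complete oracles for $x_1,\dots,x_k$ in $(\mathcal{B}_1,\nu_1),\dots,(\mathcal{B}_k,\nu_k)$ respectively. Then there is a basic representation of $$P=\{s\in S:\varpi_1^n(s)=x_1,\ \varpi_2^n(s)=x_2,\ \dots,\ \varpi_k^n(s)=x_k\}$$ in $(\mathcal{B},\nu)$ that is recursively enumerable relative to $R,\phi_1,\dots,\phi_k$ uniformly.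
   Context: $\varpi_i^n(x_1,\dots,x_n)=x_i$ is the Cartesian projection; a physical model $(S,A)$ is in normal form iff $S\subseteq\mathbb{R}^n$ and its observable quantities are $\varpi_1^n,\dots,\varpi_n^n$. An effective topology $(\mathcal{B},\nu)$ on a set $X$ consists of a countable basis $\mathcal{B}$ of a $T_0$ topology on $X$ and a coding $\nu$, i.e. a (not necessarily injective) assignment $m\mapsto\nu(m)$ of basis elements to non-negative integers under which every basis element is coded; $\mathrm{dom}_{\mathcal{B}}\nu=\{m:\nu(m)\in\mathcal{B}\}$. A local basis for $x$ is a set $\mathcal{L}_x\subseteq\mathcal{B}$ of sets containing $x$ such that each $B\in\mathcal{B}$ containing $x$ has a subset in $\mathcal{L}_x$. An oracle for $x$ is a function $\phi:\mathbb{N}\to\mathrm{dom}_{\mathcal{B}}\nu$ with $\{\nu(\phi(m))\}_m$ a local basis for $x$; it is complete iff every $m\in\mathrm{dom}_{\mathcal{B}}\nu$ with $x\in\nu(m)$ is in its range. A set $R\subseteq\mathbb{N}$ is a basic representation of $Y\subseteq X$ iff $R\subseteq\mathrm{dom}_{\mathcal{B}}\nu$ and for all $x\in X$, $x\in Y$ iff some local basis for $x$ is contained in $\{\nu(r):r\in R\}$. Given sets $X_i$ with $\varpi_i^n(S)\subseteq X_i\subseteq\mathbb{R}$ and effective topologies $(\mathcal{B}_i,\nu_i)$ on $X_i$, the effective product $(\mathcal{B}_1,\nu_1)\otimes\cdots\otimes(\mathcal{B}_n,\nu_n)$ is the effective topology on $X_1\times\cdots\times X_n$ with basis $\{B_1\times\cdots\times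 B_n: B_i\in\mathcal{B}_i\}$ and coding $\nu\langle a_1,\dots,a_n\rangle=\nu_1(a_1)\times\cdots\times\nu_n(a_n)$, where $\langle a_1,\dots,a_n\rangle$ is the iterated Cantor pairing code ($\langle x,y\rangle=\frac12(x^2+2xy+y^2+3x+y)$, $\langle a_1,\dots,a_n\rangle=\langle\langle a_1,\dots,a_{n-1}\rangle,a_n\rangle$). A physical model $(R,H)$ is a basic representation of $(S,A)$ iff $R$ is a basic representation of $S$ in this product and $H=\{\pi_1^n,\dots,\pi_n^n\}$, where $\pi_i^n\langle a_1,\dots,a_n\rangle=a_i$. "Recursively enumerable relative to $R,\phi_1,\dots,\phi_k$ uniformly" means enumerated by a single oracle machine using these as oracles. *)

theory Defs
  imports "HOL-Analysis.Analysis" "HOL-Library.Nat_Bijection"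
begin

section \<open>Cantor codes of tuples\<close>

text \<open>The Cantor pairing function is the library function \<^const>\<open>prod_encode\<close>.\<close>

lemma prod_encode_eq_cantor:
  "prod_encode (x, y) = (x\<^sup>2 + 2 * x * y + y\<^sup>2 + 3 * x + y) div 2"
proof -
  have "x\<^sup>2 + 2 * x * y + y\<^sup>2 + 3 * x + y = (x + y) * Suc (x + y) + x * 2"
    by (simp add: power2_eq_square algebra_simps)
  then show ?thesis
    by (simp add: prod_encode_def triangle_def)
qed

text \<open>A tuple \<open>(a\<^sub>1, \<dots>, a\<^sub>n)\<close> is a function on indices, of which only the values at
  \<open>1, \<dots>, n\<close> matter. The case \<open>n = 0\<close> carries no meaning.\<close>

fun tuple_code :: "nat \<Rightarrow> (nat \<Rightarrow> nat) \<Rightarrow> nat" where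
  "tuple_code 0 a = 0"
| "tuple_code (Suc 0) a = a 1"
| "tuple_code (Suc (Suc n)) a = prod_encode (tuple_code (Suc n) a, a (Suc (Suc n)))"

fun code_proj :: "nat \<Rightarrow> nat \<Rightarrow> nat \<Rightarrow> nat" where
  "code_proj 0 i m = m"
| "code_proj (Suc 0) i m = m"
| "code_proj (Suc (Suc n)) i m =
    (if i = Suc (Suc n) then snd (prod_decode m) else code_proj (Suc n) i (fst (prod_decode m)))"

lemma code_proj_tuple_code: "i \<in> {1..n} \<Longrightarrow> code_proj n i (tuple_code n a) = a i"
proof (induction n a rule: tuple_code.induct)
  case (2 a)
  then have "i = 1" by simp
  then show ?case by simp
qed auto

lemma tuple_code_cong: "(\<And>i. i \<in> {1..n} \<Longrightarrow> a i = b i) \<Longrightarrow> tuple_code n a = tuple_code n b"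
  by (induction n a rule: tuple_code.induct) auto

lemma tuple_code_code_proj: "1 \<le> n \<Longrightarrow> tuple_code n (\<lambda>i. code_proj n i m) = m"
proof (induction n arbitrary: m rule: nat_induct_at_least)
  case base
  then show ?case by simp
next
  case (Suc n)
  then obtain j where n: "n = Suc j"
    by (cases n) auto
  have "tuple_code n (\<lambda>i. code_proj (Suc n) i m)
      = tuple_code n (\<lambda>i. code_proj n i (fst (prod_decode m)))"
    by (rule tuple_code_cong) (auto simp: n)
  then show ?case
    using Suc.IH[of "fst (prod_decode m)"] by (simp add: n)
qed


section \<open>Physical models\<close>

text \<open>A set of states together with a set of observable quantities on the states.\<close>

type_synonym ('s, 'q) physical_model = "'s set \<times> ('s \<Rightarrow> 'q) set"

text \<open>Points of \<open>\<real>\<^sup>n\<close> are the elements of \<open>{1..n} \<rightarrow>\<^sub>E UNIV\<close>.\<close>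

definition cart_proj :: "nat \<Rightarrow> (nat \<Rightarrow> real) \<Rightarrow> real" where
  "cart_proj i s = s i"

definition normal_form :: "nat \<Rightarrow> (nat \<Rightarrow> real, real) physical_model \<Rightarrow> bool" where
  "normal_form n M \<longleftrightarrow> (case M of (S, A) \<Rightarrow>
     S \<subseteq> ({1..n} \<rightarrow>\<^sub>E UNIV) \<and> A = cart_proj ` {1..n})"


section \<open>Effective topologies\<close>

text \<open>A coding is a partial map from codes to sets, in which every basis element has at least one
  code. As only \<^term>\<open>{m. \<exists>U\<in>B. \<nu> m = Some U}\<close> is used as the domain, codes of sets that are
  not basis elements are permitted.\<close>

type_synonym 'a coding = "nat \<Rightarrow> 'a set option"

definition code_dom :: "'a set set \<Rightarrow> 'a coding \<Rightarrow> nat set" where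
  "code_dom B \<nu> = {m. \<exists>U\<in>B. \<nu> m = Some U}"

definition basis_of :: "'a topology \<Rightarrow> 'a set set \<Rightarrow> bool" where
  "basis_of T B \<longleftrightarrow> openin T = arbitrary union_of (\<lambda>U. U \<in> B)"

definition effective_topology :: "'a set \<Rightarrow> 'a set set \<Rightarrow> 'a coding \<Rightarrow> bool" where
  "effective_topology X B \<nu> \<longleftrightarrow>
     countable B \<and> (\<exists>T. topspace T = X \<and> basis_of T B \<and> t0_space T) \<and> B \<subseteq> ran \<nu>"

definition T1_effective_topology :: "'a set \<Rightarrow> 'a set set \<Rightarrow> 'a coding \<Rightarrow> bool" where
  "T1_effective_topology X B \<nu> \<longleftrightarrow>
     effective_topology X B \<nu> \<and> (\<exists>T. topspace T = X \<and> basis_of T B \<and> t1_space T)"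

definition prod_basis :: "nat \<Rightarrow> (nat \<Rightarrow> 'a set set) \<Rightarrow> (nat \<Rightarrow> 'a) set set" where
  "prod_basis n B = {Pi\<^sub>E {1..n} U | U. \<forall>i\<in>{1..n}. U i \<in> B i}"

definition prod_coding :: "nat \<Rightarrow> (nat \<Rightarrow> 'a coding) \<Rightarrow> (nat \<Rightarrow> 'a) coding" where
  "prod_coding n \<nu> m =
     (if \<forall>i\<in>{1..n}. \<nu> i (code_proj n i m) \<noteq> None
      then Some (Pi\<^sub>E {1..n} (\<lambda>i. the (\<nu> i (code_proj n i m))))
      else None)"

definition local_basis :: "'a set set \<Rightarrow> 'a \<Rightarrow> 'a set set \<Rightarrow> bool" where
  "local_basis B x L \<longleftrightarrow>
     L \<subseteq> B \<and> (\<forall>U\<in>L. x \<in> U) \<and> (\<forall>U\<in>B. x \<in> U \<longrightarrow> (\<exists>V\<in>L. V \<subseteq> U))"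

definition oracle_for :: "'a set set \<Rightarrow> 'a coding \<Rightarrow> 'a \<Rightarrow> (nat \<Rightarrow> nat) \<Rightarrow> bool" where
  "oracle_for B \<nu> x \<phi> \<longleftrightarrow>
     range \<phi> \<subseteq> code_dom B \<nu> \<and> local_basis B x (range (\<lambda>m. the (\<nu> (\<phi> m))))"

definition complete_oracle_for :: "'a set set \<Rightarrow> 'a coding \<Rightarrow> 'a \<Rightarrow> (nat \<Rightarrow> nat) \<Rightarrow> bool" where
  "complete_oracle_for B \<nu> x \<phi> \<longleftrightarrow>
     oracle_for B \<nu> x \<phi> \<and> (\<forall>m\<in>code_dom B \<nu>. x \<in> the (\<nu> m) \<longrightarrow> m \<in> range \<phi>)"

definition basic_representation ::
  "'a set \<Rightarrow> 'a set set \<Rightarrow> 'a coding \<Rightarrow> nat set \<Rightarrow> 'a set \<Rightarrow> bool" where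
  "basic_representation X B \<nu> R Y \<longleftrightarrow>
     Y \<subseteq> X \<and> R \<subseteq> code_dom B \<nu> \<and>
     (\<forall>x\<in>X. x \<in> Y \<longleftrightarrow> (\<exists>L. local_basis B x L \<and> L \<subseteq> (\<lambda>r. the (\<nu> r)) ` R))"

definition basic_representation_model ::
  "nat \<Rightarrow> (nat \<Rightarrow> real set) \<Rightarrow> (nat \<Rightarrow> real set set) \<Rightarrow> (nat \<Rightarrow> real coding) \<Rightarrow>
   (nat, nat) physical_model \<Rightarrow> (nat \<Rightarrow> real, real) physical_model \<Rightarrow> bool" where
  "basic_representation_model n X B \<nu> N M \<longleftrightarrow> (case (N, M) of ((R, H), (S, A)) \<Rightarrow>
     basic_representation (Pi\<^sub>E {1..n} X) (prod_basis n B) (prod_coding n \<nu>) R S \<and>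
     H = code_proj n ` {1..n})"


section \<open>Oracle machines\<close>

text \<open>Unlimited register machines with oracles. The instruction \<open>Query j r\<close> replaces the content of
  register \<open>r\<close> by the answer of the \<open>j\<close>-th oracle to it (and has no effect if there is no such
  oracle). A machine halts when its program counter leaves the program; the input is placed in
  register \<open>0\<close>, where the output is also read off.\<close>

datatype instr =
    Zero nat
  | Succ nat
  | Transfer nat nat
  | Jump nat nat nat
  | Query nat nat

type_synonym machine = "instr list"

type_synonym config = "nat \<times> (nat \<Rightarrow> nat)"

fun exec_instr :: "(nat \<Rightarrow> nat) list \<Rightarrow> instr \<Rightarrow> config \<Rightarrow> config" where
  "exec_instr os (Zero a) (pc, r) = (Suc pc, r(a := 0))"
| "exec_instr os (Succ a) (pc, r) = (Suc pc, r(a := Suc (r a)))"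
| "exec_instr os (Transfer a b) (pc, r) = (Suc pc, r(b := r a))"
| "exec_instr os (Jump a b q) (pc, r) = (if r a = r b then q else Suc pc, r)"
| "exec_instr os (Query j a) (pc, r) =
     (Suc pc, if j < length os then r(a := (os ! j) (r a)) else r)"

definition step :: "(nat \<Rightarrow> nat) list \<Rightarrow> machine \<Rightarrow> config \<Rightarrow> config" where
  "step os M c = (if fst c < length M then exec_instr os (M ! fst c) c else c)"

definition computes :: "(nat \<Rightarrow> nat) list \<Rightarrow> machine \<Rightarrow> nat \<Rightarrow> nat \<Rightarrow> bool" where
  "computes os M x y \<longleftrightarrow>
     (\<exists>t pc r. (step os M ^^ t) (0, (\<lambda>_. 0)(0 := x)) = (pc, r) \<and> length M \<le> pc \<and> r 0 = y)"

text \<open>The set enumerated by a machine is the range of the partial function that it computes.\<close>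

definition enumerates :: "(nat \<Rightarrow> nat) list \<Rightarrow> machine \<Rightarrow> nat set \<Rightarrow> bool" where
  "enumerates os M Q \<longleftrightarrow> Q = {y. \<exists>x. computes os M x y}"

text \<open>Oracle \<open>0\<close> is the characteristic function of \<open>R\<close>, oracle \<open>i\<close> is \<open>\<phi>\<^sub>i\<close> for \<open>1 \<le> i \<le> k\<close>.\<close>

definition oracle_list :: "nat set \<Rightarrow> nat \<Rightarrow> (nat \<Rightarrow> nat \<Rightarrow> nat) \<Rightarrow> (nat \<Rightarrow> nat) list" where
  "oracle_list R k \<phi> = (\<lambda>m. of_bool (m \<in> R)) # map \<phi> [1..<Suc k]"

end

theory Submission
  imports Defs
begin

text \<open>Let \<open>Q\<close> be the set of all \<open>r \<in> R\<close> with \<open>\<pi>\<^sub>i r \<in> range \<phi>\<^sub>i\<close> for every \<open>i \<le> k\<close>. By completeness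
  of the oracles, every basic neighbourhood of a point of \<open>P\<close> that has a code in \<open>R\<close> has it in \<open>Q\<close>.
  Conversely, if the sets coded by \<open>Q\<close> contain a local basis for \<open>s\<close>, then each set in
  it contains every point obtained from \<open>s\<close> by replacing a coordinate \<open>s\<^sub>i\<close>, \<open>i \<le> k\<close>, by \<open>x\<^sub>i\<close>; hence
  \<open>s\<^sub>i = x\<^sub>i\<close> by the \<open>T\<^sub>1\<close> axiom. A machine enumerates \<open>Q\<close> by reading its input as a code of some
  \<open>m\<close> and of guessed arguments \<open>g\<^sub>1, \<dots>, g\<^sub>k\<close>, diverging unless \<open>m \<in> R\<close> and
  \<open>\<phi>\<^sub>i g\<^sub>i = \<pi>\<^sub>i m\<close> for all \<open>i \<le> k\<close>, and returning \<open>m\<close>.\<close>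

section \<open>Structured register machine programs\<close>

definition reaches :: "(nat \<Rightarrow> nat) list \<Rightarrow> machine \<Rightarrow> config \<Rightarrow> config \<Rightarrow> bool" where
  "reaches os M c c' \<longleftrightarrow> (\<exists>t. (step os M ^^ t) c = c')"

lemma reaches_refl: "reaches os M c c"
  unfolding reaches_def by (rule exI[of _ 0]) simp

lemma reaches_trans [trans]: "reaches os M a b \<Longrightarrow> reaches os M b c \<Longrightarrow> reaches os M a c"
  unfolding reaches_def 
proof (elim exE)
  fix s t assume "(step os M ^^ s) a = b" "(step os M ^^ t) b = c"
  then have "(step os M ^^ (t + s)) a = c"
    by (simp add: funpow_add)
  then show "\<exists>t. (step os M ^^ t) a = c" ..
qed

lemma reaches_step: "step os M c = c' \<Longrightarrow> reaches os M c c'"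
  unfolding reaches_def by (rule exI[of _ 1]) simp

lemma funpow_step_halted: "length M \<le> fst c \<Longrightarrow> (step os M ^^ t) c = c"
  by (induction t) (auto simp: step_def)

text \<open>The machine is deterministic, so all configurations reachable from \<open>c\<close> lie
  on one orbit, ordered by step count.\<close>

lemma reaches_linear:
  assumes "reaches os M c c1" "reaches os M c c2"
  shows "reaches os M c1 c2 \<or> reaches os M c2 c1"
proof -
  have *: "reaches os M ((step os M ^^ s) c) ((step os M ^^ t) c)" if "s \<le> t" for s t
    unfolding reaches_def using that
    by (intro exI[of _ "t - s"]) (simp flip: funpow_add o_apply[of "step os M ^^ (t - s)"])
  obtain s t where "(step os M ^^ s) c = c1" "(step os M ^^ t) c = c2"
    using assms unfolding reaches_def by blast
  then show ?thesis
    using *[of s t] *[of t s] nat_le_linear[of s t] by blast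
qed

definition diverges :: "(nat \<Rightarrow> nat) list \<Rightarrow> machine \<Rightarrow> config \<Rightarrow> bool" where
  "diverges os M c \<longleftrightarrow> (\<forall>c'. reaches os M c c' \<longrightarrow> fst c' < length M)"

lemma halted_reaches: "length M \<le> fst c \<Longrightarrow> reaches os M c c' \<Longrightarrow> c' = c"
  by (auto simp: reaches_def funpow_step_halted)

text \<open>A configuration that comes before \<open>c'\<close> on the orbit cannot have halted: a
  halted one stays put, so it would be \<open>c'\<close> itself, which has not halted.\<close>

lemma reaches_diverges:
  assumes "reaches os M c c'" "diverges os M c'"
  shows "diverges os M c"
  unfolding diverges_def
proof (intro allI impI)
  fix d assume "reaches os M c d"
  with assms(1) consider "reaches os M c' d" | "reaches os M d c'"
    using reaches_linear by blast
  then show "fst d < length M"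
  proof cases
    case 1
    then show ?thesis
      using assms(2) unfolding diverges_def by blast
  next
    case 2
    show ?thesis
    proof (rule ccontr)
      assume "\<not> fst d < length M"
      then have "c' = d"
        using 2 halted_reaches by (meson not_less)
      then show False
        using \<open>\<not> fst d < length M\<close> assms(2) reaches_refl unfolding diverges_def by blast
    qed
  qed
qed

section \<open>Program blocks and their effect on the registers\<close>

definition block_at :: "machine \<Rightarrow> nat \<Rightarrow> machine \<Rightarrow> bool" where
  "block_at M p c \<longleftrightarrow> (\<forall>i<length c. p + i < length M \<and> M ! (p + i) = c ! i)"

lemma block_at_Nil [simp]: "block_at M p []"
  by (simp add: block_at_def)

lemma block_at_Cons [simp]:
  "block_at M p (x # c) \<longleftrightarrow> p < length M \<and> M ! p = x \<and> block_at M (Suc p) c"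
  by (auto simp: block_at_def All_less_Suc2)

lemma block_at_append [simp]:
  "block_at M p (c @ d) \<longleftrightarrow> block_at M p c \<and> block_at M (p + length c) d"
  by (induction c arbitrary: p) auto

text \<open>As jump targets are absolute, a block is a function of the address at which it is placed.\<close>

type_synonym block = "nat \<Rightarrow> machine"

text \<open>The result \<open>None\<close> stands for divergence of the whole machine.\<close>

definition runs ::
  "(nat \<Rightarrow> nat) list \<Rightarrow> block \<Rightarrow> (nat \<Rightarrow> nat) \<Rightarrow> (nat \<Rightarrow> nat) option \<Rightarrow> bool" where
  "runs os c r res \<longleftrightarrow> (\<forall>M p. block_at M p (c p) \<longrightarrow>
     (case res of
        None \<Rightarrow> diverges os M (p, r)
      | Some r' \<Rightarrow> reaches os M (p, r) (p + length (c p), r')))"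

lemma runs_SomeD:
  "runs os c r (Some r') \<Longrightarrow> block_at M p (c p) \<Longrightarrow>
     reaches os M (p, r) (p + length (c p), r')"
  by (simp add: runs_def)

definition single :: "instr \<Rightarrow> block" where
  "single i p = [i]"

definition skip :: block where
  "skip p = []"

definition seq :: "block \<Rightarrow> block \<Rightarrow> block"  (infixr \<open>;;\<close> 60) where
  "(c ;; d) p = c p @ d (p + length (c p))"

text \<open>\<open>Jump 0 0 q\<close> is unconditional, as a register agrees with itself. The offset
  2 counts the two jumps before the body.\<close>

definition when_eq :: "nat \<Rightarrow> nat \<Rightarrow> block \<Rightarrow> block" where
  "when_eq a b c p =
     Jump a b (p + 2) # Jump 0 0 (p + 2 + length (c (p + 2))) # c (p + 2)"

definition until_eq :: "nat \<Rightarrow> nat \<Rightarrow> block \<Rightarrow> block" where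
  "until_eq a b c p = Jump a b (p + 2 + length (c (Suc p))) # c (Suc p) @ [Jump 0 0 p]"

text \<open>The program \<open>until_eq a b skip\<close> asserts that registers \<open>a\<close> and \<open>b\<close> agree.\<close>

lemma runs_skip: "runs os skip r (Some r)"
  by (simp add: runs_def skip_def reaches_refl)

lemma runs_Zero: "runs os (single (Zero a)) r (Some (r(a := 0)))"
  and runs_Succ: "runs os (single (Succ a)) r (Some (r(a := Suc (r a))))"
  and runs_Transfer: "runs os (single (Transfer a b)) r (Some (r(b := r a)))"
  and runs_Query:
    "j < length os \<Longrightarrow> runs os (single (Query j a)) r (Some (r(a := (os ! j) (r a))))"
  by (auto simp: runs_def single_def step_def intro!: reaches_step)

lemma runs_seq: "runs os c r (Some r') \<Longrightarrow> runs os d r' res \<Longrightarrow> runs os (c ;; d) r res"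
  by (force simp: runs_def seq_def add.assoc split: option.splits
      intro: reaches_trans reaches_diverges)

lemma runs_seq_None: "runs os c r None \<Longrightarrow> runs os (c ;; d) r None"
  by (simp add: runs_def seq_def)

lemma runs_when_eq_True:
  assumes "r a = r b" "runs os c r (Some r')"
  shows "runs os (when_eq a b c) r (Some r')"
  unfolding runs_def
proof (intro allI impI)
  fix M p assume at: "block_at M p (when_eq a b c p)"
  then have "reaches os M (p, r) (p + 2, r)"
    using assms(1) by (intro reaches_step) (simp add: when_eq_def step_def)
  also have "reaches os M (p + 2, r) (p + 2 + length (c (p + 2)), r')"
    using at by (intro runs_SomeD[OF assms(2)]) (simp add: when_eq_def)
  finally show "case Some r' of None \<Rightarrow> diverges os M (p, r)
      | Some r' \<Rightarrow> reaches os M (p, r) (p + length (when_eq a b c p), r')"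
    by (simp add: when_eq_def)
qed

lemma runs_when_eq_False: "r a \<noteq> r b \<Longrightarrow> runs os (when_eq a b c) r (Some r)"
  by (auto simp: runs_def when_eq_def step_def
      intro!: reaches_trans[OF reaches_step reaches_step])

lemma runs_until_eq_done: "r a = r b \<Longrightarrow> runs os (until_eq a b c) r (Some r)"
  by (auto simp: runs_def until_eq_def step_def intro!: reaches_step)

text \<open>One round of the loop. Facts about terminating loops follow by induction on the rounds
  left, with \<open>runs_until_eq_done\<close> as base.\<close>

lemma runs_until_eq_step:
  assumes "r a \<noteq> r b" "runs os c r (Some r1)" "runs os (until_eq a b c) r1 (Some r2)"
  shows "runs os (until_eq a b c) r (Some r2)"
  unfolding runs_def
proof (intro allI impI)
  fix M p assume at: "block_at M p (until_eq a b c p)"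
  let ?q = "Suc p + length (c (Suc p))"
  have "reaches os M (p, r) (Suc p, r)"
    using at assms(1) by (intro reaches_step) (simp add: until_eq_def step_def)
  also have "reaches os M (Suc p, r) (?q, r1)"
    using at by (intro runs_SomeD[OF assms(2)]) (simp add: until_eq_def)
  also have "reaches os M (?q, r1) (p, r1)"
    using at by (intro reaches_step) (simp add: until_eq_def step_def)
  also have "reaches os M (p, r1) (p + length (until_eq a b c p), r2)"
    using at by (rule runs_SomeD[OF assms(3)])
  finally show "case Some r2 of None \<Rightarrow> diverges os M (p, r)
      | Some r' \<Rightarrow> reaches os M (p, r) (p + length (until_eq a b c p), r')"
    by simp
qed

lemma runs_until_eq_skip_None:
  assumes "r a \<noteq> r b"
  shows "runs os (until_eq a b skip) r None"
  unfolding runs_def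
proof (intro allI impI)
  fix M p assume at: "block_at M p (until_eq a b skip p)"
  \<comment> \<open>With an empty body the registers never change, so the machine alternates between
    the test at \<open>p\<close> and the jump back at \<open>Suc p\<close>.\<close>
  have "(step os M ^^ t) (p, r) \<in> {(p, r), (Suc p, r)}" for t
  proof (induction t)
    case (Suc t)
    then show ?case
      using at assms
      by (auto simp add: until_eq_def skip_def step_def)
  qed simp
  then have "fst ((step os M ^^ t) (p, r)) < length M" for t
    using at by (smt (verit) Suc_lessD block_at_Cons append_Cons append_Nil fst_conv insertE
        singletonD skip_def until_eq_def)
  then show "case None of None \<Rightarrow> diverges os M (p, r)
      | Some r' \<Rightarrow> reaches os M (p, r) (p + length (until_eq a b skip p), r')"
    unfolding diverges_def reaches_def by (simp del: split_paired_All) blast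
qed

section \<open>Whole programs and the values they compute\<close>

lemma block_at_self: "block_at c 0 c"
  by (simp add: block_at_def)

lemma computes_iff_reaches:
  "computes os M x y \<longleftrightarrow>
     (\<exists>pc r. reaches os M (0, (\<lambda>_. 0)(0 := x)) (pc, r) \<and> length M \<le> pc \<and> r 0 = y)"
  unfolding computes_def reaches_def by blast

text \<open>Orbits are linear and halted configurations are fixed points, so at most one halted
  configuration is reached, and it determines the output.\<close>

lemma runs_Some_computes_iff:
  assumes "runs os c ((\<lambda>_. 0)(0 := x)) (Some r)"
  shows "computes os (c 0) x y \<longleftrightarrow> y = r 0"
proof -
  let ?init = "(0, (\<lambda>_. 0)(0 := x))" and ?halt = "(length (c 0), r)"
  have halt: "reaches os (c 0) ?init ?halt"
    using assms block_at_self by (force simp: runs_def)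
  have "(pc, r') = ?halt" if "reaches os (c 0) ?init (pc, r')" "length (c 0) \<le> pc" for pc r'
    using reaches_linear[OF halt that(1)] halted_reaches[of "c 0" ?halt]
      halted_reaches[of "c 0" "(pc, r')"] that(2) by fastforce
  then show ?thesis
    using halt unfolding computes_iff_reaches by blast
qed

lemma runs_None_not_computes:
  assumes "runs os c ((\<lambda>_. 0)(0 := x)) None"
  shows "\<not> computes os (c 0) x y"
  using assms block_at_self by (force simp: runs_def diverges_def computes_iff_reaches)

section \<open>The enumerating machine\<close>

text \<open>The Cantor numbering runs along the diagonals on which \<open>x + y\<close> is constant,
  with \<open>x\<close> increasing; after \<open>y = 0\<close> the next diagonal starts at first
  component 0.\<close>

lemma prod_decode_step:
  assumes "prod_decode m = (x, y)"
  shows "prod_decode (Suc m) = (if y = 0 then (0, Suc x) else (Suc x, y - 1))"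
proof -
  have m: "m = prod_encode (x, y)"
    using assms by (metis prod_decode_inverse)
  have "Suc m = prod_encode (if y = 0 then (0, Suc x) else (Suc x, y - 1))"
    by (cases y) (auto simp: m prod_encode_def)
  then show ?thesis
    by simp
qed

text \<open>Registers 5, 6, 7 hold \<open>x\<close>, \<open>x + y + 1\<close> and \<open>m\<close> where \<open>(x, y) = prod_decode m\<close>;
  keeping \<open>x + y + 1\<close> instead of \<open>y\<close> avoids decrements.\<close>

definition next_pair :: block where
  "next_pair = single (Succ 7) ;; single (Succ 5) ;;
     when_eq 5 6 (single (Zero 5) ;; single (Succ 6))"

text \<open>The pairing is inverted by counting: \<open>next_pair\<close> is iterated from the pair
  with code 0 until the counter in register 7 equals the code in \<open>a\<close>. The second
  component is then the distance from \<open>x + 1\<close> to \<open>x + y + 1\<close>, measured in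
  \<open>b\<close>.\<close>

definition decode :: "nat \<Rightarrow> nat \<Rightarrow> block" where
  "decode a b = single (Zero 5) ;; single (Zero 6) ;; single (Succ 6) ;; single (Zero 7) ;;
     until_eq 7 a next_pair ;; single (Transfer 5 a) ;; single (Zero b) ;; single (Succ 5) ;;
     until_eq 5 6 (single (Succ 5) ;; single (Succ b))"

abbreviation pair_state :: "(nat \<Rightarrow> nat) \<Rightarrow> nat \<Rightarrow> nat \<Rightarrow> nat" where
  "pair_state r m \<equiv> r(5 := fst (prod_decode m),
     6 := Suc (fst (prod_decode m) + snd (prod_decode m)), 7 := m)"

lemma runs_next_pair: "runs os next_pair (pair_state r m) (Some (pair_state r (Suc m)))"
proof -
  obtain x y where xy: "prod_decode m = (x, y)"
    by fastforce
  \<comment> \<open>The state after both increments. Registers 5 and 6 then agree iff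
    \<open>y = 0\<close>, that is, at the end of a diagonal.\<close>
  let ?r = "r(5 := Suc x, 6 := Suc (x + y), 7 := Suc m)"
  have wrap: "runs os (when_eq 5 6 (single (Zero 5) ;; single (Succ 6))) ?r
      (Some (pair_state r (Suc m)))"
  proof (cases "y = 0")
    case True
    have "runs os (single (Zero 5) ;; single (Succ 6)) ?r
        (Some (?r(5 := 0, 6 := Suc ((?r(5 := 0)) 6))))"
      by (rule runs_seq[OF runs_Zero runs_Succ])
    moreover have "?r(5 := 0, 6 := Suc ((?r(5 := 0)) 6)) = pair_state r (Suc m)"
      using True by (auto simp: prod_decode_step[OF xy])
    ultimately show ?thesis
      using True by (intro runs_when_eq_True) auto
  next
    case False
    then have "?r = pair_state r (Suc m)"
      by (auto simp: prod_decode_step[OF xy])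
    then show ?thesis
      using False runs_when_eq_False[of ?r 5 6] by simp
  qed
  have "(pair_state r m)(7 := Suc ((pair_state r m) 7),
      5 := Suc (((pair_state r m)(7 := Suc ((pair_state r m) 7))) 5)) = ?r"
    by (auto simp: xy)
  then show ?thesis
    unfolding next_pair_def using wrap
    by (intro runs_seq[OF runs_Succ] runs_seq[OF runs_Succ]) simp
qed

lemma runs_until_eq_next_pair:
  assumes "a \<notin> {5, 6, 7}" "d \<le> r a"
  shows "runs os (until_eq 7 a next_pair) (pair_state r (r a - d)) (Some (pair_state r (r a)))"
  using assms(2)
proof (induction d)
  case 0
  then show ?case
    unfolding diff_zero using assms(1) by (intro runs_until_eq_done) simp
next
  case (Suc d)
  then have "Suc (r a - Suc d) = r a - d"
    by simp
  then have body: "runs os next_pair (pair_state r (r a - Suc d)) (Some (pair_state r (r a - d)))"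
    using runs_next_pair[of os r "r a - Suc d"] by (simp only:)
  have "pair_state r (r a - Suc d) 7 \<noteq> pair_state r (r a - Suc d) a"
    using Suc.prems assms(1) by simp
  then show ?case
    using body Suc.IH[OF Suc_leD[OF Suc.prems]] by (rule runs_until_eq_step)
qed

text \<open>Subtraction by increments: each round closes the gap \<open>d\<close> between registers
  5 and 6 by one and adds one to \<open>b\<close>.\<close>

lemma runs_until_eq_difference:
  assumes "b \<notin> {5, 6}" "r 5 + d = r 6"
  shows "runs os (until_eq 5 6 (single (Succ 5) ;; single (Succ b))) r
           (Some (r(5 := r 6, b := r b + d)))"
  using assms(2)
proof (induction d arbitrary: r)
  case 0
  then have "r(5 := r 6, b := r b + 0) = r"
    by auto
  then show ?case
    using runs_until_eq_done[of r 5 6] 0 by (simp only: simp_thms add_0_right)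
next
  case (Suc d)
  let ?r = "r(5 := Suc (r 5), b := Suc ((r(5 := Suc (r 5))) b))"
  have final: "?r(5 := ?r 6, b := ?r b + d) = r(5 := r 6, b := r b + Suc d)"
    by (rule ext) (use assms(1) in simp)
  have "runs os (until_eq 5 6 (single (Succ 5) ;; single (Succ b))) ?r
      (Some (?r(5 := ?r 6, b := ?r b + d)))"
    by (rule Suc.IH) (use Suc.prems assms(1) in simp)
  then have "runs os (until_eq 5 6 (single (Succ 5) ;; single (Succ b))) ?r
      (Some (r(5 := r 6, b := r b + Suc d)))"
    unfolding final .
  moreover have "r 5 \<noteq> r 6"
    using Suc.prems by simp
  ultimately show ?case
    using runs_until_eq_step[OF _ runs_seq[OF runs_Succ runs_Succ]] by blast
qed

lemma runs_decode:
  assumes "a < 5" "b < 5" "a \<noteq> b"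
  shows "\<exists>r'. runs os (decode a b) r (Some r') \<and> r' a = fst (prod_decode (r a)) \<and>
           r' b = snd (prod_decode (r a)) \<and> (\<forall>c<5. c \<noteq> a \<longrightarrow> c \<noteq> b \<longrightarrow> r' c = r c)"
proof -
  obtain x y where xy: "prod_decode (r a) = (x, y)"
    by fastforce
  have ab: "a \<notin> {5, 6, 7}" "b \<notin> {5, 6}" "b \<noteq> 7"
    using assms by auto
  have "prod_decode 0 = (0, 0)"
    by (simp add: prod_decode_def prod_decode_aux.simps)
  \<comment> \<open>The initialized state is the loop state with all \<open>r a\<close> rounds still
    to go.\<close>
  then have init:
    "r(5 := 0, 6 := 0, 6 := Suc ((r(5 := 0, 6 := 0)) 6), 7 := 0) = pair_state r (r a - r a)"
    by auto
  let ?p = "pair_state r (r a)"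
  \<comment> \<open>Register 5 is raised to \<open>x + 1\<close> so that its gap to register 6 is
    exactly \<open>y\<close>.\<close>
  let ?q = "?p(a := ?p 5, b := 0, 5 := Suc ((?p(a := ?p 5, b := 0)) 5))"
  have q: "?q = r(6 := Suc (x + y), 7 := r a, a := x, b := 0, 5 := Suc x)"
    using ab xy by (auto simp: fun_eq_iff)
  have "runs os (until_eq 5 6 (single (Succ 5) ;; single (Succ b))) ?q
      (Some (?q(5 := ?q 6, b := ?q b + y)))"
    unfolding q by (rule runs_until_eq_difference) (use ab in auto)
  then have "runs os (decode a b) r (Some (?q(5 := ?q 6, b := ?q b + y)))"
    unfolding decode_def
    apply (intro runs_seq[OF runs_Zero] runs_seq[OF runs_Succ])
    apply (subst init)
    apply (rule runs_seq[OF runs_until_eq_next_pair[OF ab(1) order_refl]])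
    apply (intro runs_seq[OF runs_Transfer] runs_seq[OF runs_Zero] runs_seq[OF runs_Succ])
    apply assumption
    done
  then show ?thesis
    unfolding q using assms ab xy by - (rule exI, rule conjI, assumption, auto)
qed

section \<open>Testing the components of a candidate\<close>

text \<open>Membership in the range of an oracle is in general only semi-decidable, so an argument
  is popped from the guesses in register 1 and its oracle value is compared with register 3. For
  \<open>i > k\<close> no guess is consumed.\<close>

definition guess :: "nat \<Rightarrow> nat \<Rightarrow> block" where
  "guess k i = (if i \<le> k then decode 1 4 ;; single (Query i 4) ;; until_eq 3 4 skip else skip)"

text \<open>Register 0 holds the candidate, register 1 the code of the remaining guesses, register 2 the
  code of the remaining components of the candidate, and register 3 the current component.\<close>

fun check_components :: "nat \<Rightarrow> nat \<Rightarrow> block" where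
  "check_components k 0 = skip"
| "check_components k (Suc 0) = single (Transfer 2 3) ;; guess k 1"
| "check_components k (Suc (Suc i)) =
     decode 2 3 ;; guess k (Suc (Suc i)) ;; check_components k (Suc i)"

text \<open>Register 3 is set to 1 so that comparison with the answer of oracle 0 tests membership
  in \<open>R\<close>. A failed test loops forever, so only accepted candidates are
  returned.\<close>

definition enumerator :: "nat \<Rightarrow> nat \<Rightarrow> block" where
  "enumerator n k = decode 0 1 ;; single (Transfer 0 4) ;; single (Query 0 4) ;;
     single (Zero 3) ;; single (Succ 3) ;; until_eq 3 4 skip ;; single (Transfer 0 2) ;;
     check_components k n"

lemma runs_assert:
  "runs os (until_eq a b skip) r (if r a = r b then Some r else None)"
  by (simp add: runs_until_eq_done runs_until_eq_skip_None)

lemma runs_guess: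
  assumes "i \<le> k" "k < length os" "prod_decode (r 1) = (g, j)"
  shows "(os ! i) j = r 3 \<Longrightarrow>
           \<exists>r'. runs os (guess k i) r (Some r') \<and> r' 0 = r 0 \<and> r' 1 = g \<and> r' 2 = r 2"
    and "(os ! i) j \<noteq> r 3 \<Longrightarrow> runs os (guess k i) r None"
proof -
  obtain r' where r': "runs os (decode 1 4) r (Some r')"
      "r' 0 = r 0" "r' 1 = g" "r' 2 = r 2" "r' 3 = r 3" "r' 4 = j"
    using runs_decode[of 1 4 os r] assms(3) by auto
  let ?r = "r'(4 := (os ! i) (r' 4))"
  have runs: "runs os (guess k i) r (if ?r 3 = ?r 4 then Some ?r else None)"
    using assms unfolding guess_def
    by (simp only: if_True) (intro runs_seq[OF r'(1)] runs_seq[OF runs_Query] runs_assert; simp)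
  show "runs os (guess k i) r None" if "(os ! i) j \<noteq> r 3"
    using runs that r' by simp
  show "\<exists>r'. runs os (guess k i) r (Some r') \<and> r' 0 = r 0 \<and> r' 1 = g \<and> r' 2 = r 2"
    if "(os ! i) j = r 3"
    using runs that r' by (intro exI[of _ ?r]) simp
qed

lemma runs_guess_sound:
  assumes "k < length os"
  shows "runs os (guess k i) r None \<or>
    (\<exists>r'. runs os (guess k i) r (Some r') \<and> r' 0 = r 0 \<and> r' 2 = r 2 \<and>
       (i \<le> k \<longrightarrow> r 3 \<in> range (os ! i)))"
proof (cases "i \<le> k")
  case True
  obtain g j where "prod_decode (r 1) = (g, j)"
    by fastforce
  then show ?thesis
    using runs_guess[OF True assms] by (metis rangeI)
next
  case False
  then show ?thesis
    using runs_skip by (auto simp: guess_def)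
qed

text \<open>\<open>g'\<close> is chosen before \<open>r\<close> because it becomes part of the
  machine's input. The given \<open>g\<close> codes the guesses that the later tests will
  need.\<close>

lemma runs_guess_complete:
  assumes "k < length os" "i \<le> k \<Longrightarrow> v \<in> range (os ! i)"
  shows "\<exists>g'. \<forall>r. r 3 = v \<longrightarrow> r 1 = g' \<longrightarrow>
    (\<exists>r'. runs os (guess k i) r (Some r') \<and> r' 0 = r 0 \<and> r' 1 = g \<and> r' 2 = r 2)"
proof (cases "i \<le> k")
  case True
  then obtain j where j: "v = (os ! i) j"
    using assms(2) by blast
  show ?thesis
    using j runs_guess(1)[OF True assms(1)]
    by (intro exI[of _ "prod_encode (g, j)"]) (metis prod_encode_inverse)
next
  case False
  then show ?thesis
    using runs_skip by (intro exI[of _ g]) (auto simp: guess_def)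
qed

text \<open>Components are peeled off from the last to the first, in step with the recursion of
  \<open>code_proj\<close>; after each split register 2 holds the code of the shorter tuple, to
  which the induction hypothesis applies.\<close>

lemma runs_check_components_sound:
  assumes "k < length os"
  shows "runs os (check_components k n) r None \<or>
    (\<exists>r'. runs os (check_components k n) r (Some r') \<and> r' 0 = r 0 \<and>
       (\<forall>i\<in>{1..n}. i \<le> k \<longrightarrow> code_proj n i (r 2) \<in> range (os ! i)))"
  using assms
proof (induction k n arbitrary: r rule: check_components.induct)
  case (1 k)
  then show ?case
    using runs_skip by auto
next
  case (2 k)
  have runs: "runs os (check_components k (Suc 0)) r res"
    if "runs os (guess k 1) (r(3 := r 2)) res" for res
    using that unfolding check_components.simps by (intro runs_seq[OF runs_Transfer])
  show ?case
    using runs_guess_sound[OF 2, of 1 "r(3 := r 2)"]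
  proof (elim disjE exE conjE)
    assume "runs os (guess k 1) (r(3 := r 2)) None"
    then show ?thesis
      using runs by blast
  next
    fix r' assume *: "runs os (guess k 1) (r(3 := r 2)) (Some r')" "r' 0 = (r(3 := r 2)) 0"
      "1 \<le> k \<longrightarrow> (r(3 := r 2)) 3 \<in> range (os ! 1)"
    then show ?thesis
      by (intro disjI2 exI[of _ r'] conjI runs[OF *(1)]) auto
  qed
next
  case (3 k n)
  obtain r1 where r1: "runs os (decode 2 3) r (Some r1)"
      "r1 0 = r 0" "r1 2 = fst (prod_decode (r 2))" "r1 3 = snd (prod_decode (r 2))"
    using runs_decode[of 2 3 os r] by auto
  show ?case
    using runs_guess_sound[OF 3(2), of "Suc (Suc n)" r1]
  proof (elim disjE exE conjE)
    assume "runs os (guess k (Suc (Suc n))) r1 None"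
    then have "runs os (check_components k (Suc (Suc n))) r None"
      unfolding check_components.simps by (intro runs_seq[OF r1(1)] runs_seq_None)
    then show ?thesis ..
  next
    fix r2 assume r2: "runs os (guess k (Suc (Suc n))) r1 (Some r2)" "r2 0 = r1 0" "r2 2 = r1 2"
      "Suc (Suc n) \<le> k \<longrightarrow> r1 3 \<in> range (os ! Suc (Suc n))"
    have runs: "runs os (check_components k (Suc (Suc n))) r res"
      if "runs os (check_components k (Suc n)) r2 res" for res
      using that unfolding check_components.simps by (intro runs_seq[OF r1(1)] runs_seq[OF r2(1)])
    show ?thesis
      using 3(1)[OF 3(2), of r2]
    proof (elim disjE exE conjE)
      assume "runs os (check_components k (Suc n)) r2 None"
      then show ?thesis
        using runs by blast
    next
      fix r' assume r': "runs os (check_components k (Suc n)) r2 (Some r')" "r' 0 = r2 0"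
        "\<forall>i\<in>{1..Suc n}. i \<le> k \<longrightarrow> code_proj (Suc n) i (r2 2) \<in> range (os ! i)"
      have "code_proj (Suc (Suc n)) i (r 2) \<in> range (os ! i)"
        if "i \<in> {1..Suc (Suc n)}" "i \<le> k" for i
      proof (cases "i = Suc (Suc n)")
        case True
        then show ?thesis
          using r1(4) r2(4) that by simp
      next
        case False
        then show ?thesis
          using r'(3) r1(3) r2(3) that by simp
      qed
      moreover have "r' 0 = r 0"
        using r1(2) r2(2) r'(2) by simp
      ultimately show ?thesis
        using runs[OF r'(1)] by blast
    qed
  qed
qed

text \<open>The guesses form a stack: the induction hypothesis yields the code for the earlier
  components, and the guess for the last one, which is popped first, is pushed onto it.\<close>

lemma runs_check_components_complete:
  assumes "k < length os"
    and "\<And>i. i \<in> {1..n} \<Longrightarrow> i \<le> k \<Longrightarrow> code_proj n i m \<in> range (os ! i)"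
  shows "\<exists>g. \<forall>r. r 1 = g \<longrightarrow> r 2 = m \<longrightarrow>
    (\<exists>r'. runs os (check_components k n) r (Some r') \<and> r' 0 = r 0)"
  using assms
proof (induction k n arbitrary: m rule: check_components.induct)
  case (1 k)
  then show ?case
    using runs_skip by fastforce
next
  case (2 k)
  then have "1 \<le> k \<Longrightarrow> m \<in> range (os ! 1)"
    using 2(2)[of 1] by simp
  from runs_guess_complete[OF 2(1) this] obtain g where g:
    "\<And>r. r 3 = m \<Longrightarrow> r 1 = g \<Longrightarrow> \<exists>r'. runs os (guess k 1) r (Some r') \<and> r' 0 = r 0"
    by blast
  show ?case
  proof (intro exI[of _ g] allI impI)
    fix r :: "nat \<Rightarrow> nat" assume "r 1 = g" "r 2 = m"
    then obtain r' where r': "runs os (guess k 1) (r(3 := r 2)) (Some r')" "r' 0 = r 0"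
      using g[of "r(3 := r 2)"] by auto
    then have "runs os (check_components k (Suc 0)) r (Some r')"
      unfolding check_components.simps by (intro runs_seq[OF runs_Transfer])
    then show "\<exists>r'. runs os (check_components k (Suc 0)) r (Some r') \<and> r' 0 = r 0"
      using r' by blast
  qed
next
  case (3 k n)
  let ?N = "Suc (Suc n)"
  have "code_proj (Suc n) i (fst (prod_decode m)) \<in> range (os ! i)"
    if "i \<in> {1..Suc n}" "i \<le> k" for i
    using 3(3)[of i] that by auto
  from 3(1)[OF 3(2) this] obtain g where g:
    "\<And>r. r 1 = g \<Longrightarrow> r 2 = fst (prod_decode m) \<Longrightarrow>
      \<exists>r'. runs os (check_components k (Suc n)) r (Some r') \<and> r' 0 = r 0"
    by blast
  have "?N \<le> k \<Longrightarrow> snd (prod_decode m) \<in> range (os ! ?N)"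
    using 3(3)[of ?N] by simp
  from runs_guess_complete[OF 3(2) this, of g] obtain g' where g':
    "\<And>r. r 3 = snd (prod_decode m) \<Longrightarrow> r 1 = g' \<Longrightarrow>
      \<exists>r'. runs os (guess k ?N) r (Some r') \<and> r' 0 = r 0 \<and> r' 1 = g \<and> r' 2 = r 2"
    by blast
  show ?case
  proof (intro exI[of _ g'] allI impI)
    fix r :: "nat \<Rightarrow> nat" assume r: "r 1 = g'" "r 2 = m"
    obtain r1 where r1: "runs os (decode 2 3) r (Some r1)" "r1 0 = r 0" "r1 1 = r 1"
        "r1 2 = fst (prod_decode (r 2))" "r1 3 = snd (prod_decode (r 2))"
      using runs_decode[of 2 3 os r] by auto
    obtain r2 where r2: "runs os (guess k ?N) r1 (Some r2)" "r2 0 = r1 0" "r2 1 = g"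
        "r2 2 = r1 2"
      using g'[of r1] r r1 by auto
    obtain r' where r': "runs os (check_components k (Suc n)) r2 (Some r')" "r' 0 = r2 0"
      using g[of r2] r r1 r2 by auto
    have "runs os (check_components k ?N) r (Some r')"
      unfolding check_components.simps by (intro runs_seq[OF r1(1)] runs_seq[OF r2(1)] r'(1))
    then show "\<exists>r'. runs os (check_components k ?N) r (Some r') \<and> r' 0 = r 0"
      using r1 r2 r' by auto
  qed
qed

text \<open>Leaving \<open>res\<close> open reduces a run on a candidate in \<open>R\<close> to the
  run of the component tests, whether that halts or diverges.\<close>

lemma runs_enumerator:
  assumes "0 < length os" "os ! 0 = (\<lambda>m. of_bool (m \<in> R))" "prod_decode (r 0) = (m, g)"
  shows "m \<in> R \<Longrightarrow> \<exists>r'. r' 0 = m \<and> r' 1 = g \<and> r' 2 = m \<and>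
      (\<forall>res. runs os (check_components k n) r' res \<longrightarrow> runs os (enumerator n k) r res)"
    and "m \<notin> R \<Longrightarrow> runs os (enumerator n k) r None"
proof -
  obtain r1 where r1: "runs os (decode 0 1) r (Some r1)" "r1 0 = m" "r1 1 = g"
    using runs_decode[of 0 1 os r] assms(3) by auto
  let ?r = "r1(4 := of_bool (m \<in> R), 3 := 1)"
  have runs: "runs os (enumerator n k) r res"
    if "runs os (until_eq 3 4 skip ;; single (Transfer 0 2) ;; check_components k n) ?r res" for res
  proof -
    let ?r2 = "r1(4 := r1 0)"
    let ?r3 = "?r2(4 := (os ! 0) (?r2 4), 3 := 0)"
    have "?r3(3 := Suc (?r3 3)) = ?r"
      by (rule ext) (simp add: assms(2) r1(2))
    then have "runs os (until_eq 3 4 skip ;; single (Transfer 0 2) ;; check_components k n)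
        (?r3(3 := Suc (?r3 3))) res"
      using that by (simp only:)
    then show ?thesis
      unfolding enumerator_def
      by (intro runs_seq[OF r1(1)] runs_seq[OF runs_Transfer] runs_seq[OF runs_Query[OF assms(1)]]
          runs_seq[OF runs_Zero] runs_seq[OF runs_Succ])
  qed
  show "runs os (enumerator n k) r None" if "m \<notin> R"
    using that by (intro runs runs_seq_None runs_until_eq_skip_None) simp
  show "\<exists>r'. r' 0 = m \<and> r' 1 = g \<and> r' 2 = m \<and>
      (\<forall>res. runs os (check_components k n) r' res \<longrightarrow> runs os (enumerator n k) r res)"
    if "m \<in> R"
  proof (intro exI[of _ "?r(2 := ?r 0)"] conjI allI impI runs)
    fix res assume "runs os (check_components k n) (?r(2 := ?r 0)) res"
    then show "runs os (until_eq 3 4 skip ;; single (Transfer 0 2) ;; check_components k n) ?r res"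
      using that by (intro runs_seq[OF runs_until_eq_done] runs_seq[OF runs_Transfer]) simp_all
  qed (use r1 in auto)
qed

lemma enumerates_enumerator:
  assumes "k \<le> n" "k < length os" "os ! 0 = (\<lambda>m. of_bool (m \<in> R))"
  shows "enumerates os (enumerator n k 0) {m \<in> R. \<forall>i\<in>{1..k}. code_proj n i m \<in> range (os ! i)}"
  unfolding enumerates_def
proof (intro equalityI subsetI)
  fix m assume m: "m \<in> {m \<in> R. \<forall>i\<in>{1..k}. code_proj n i m \<in> range (os ! i)}"
  then obtain g where g: "\<And>r. r 1 = g \<Longrightarrow> r 2 = m \<Longrightarrow>
      \<exists>r'. runs os (check_components k n) r (Some r') \<and> r' 0 = r 0"
    using runs_check_components_complete[OF assms(2), of n m] by auto
  let ?x = "prod_encode (m, g)"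
  let ?init = "(\<lambda>_ :: nat. 0)(0 := ?x)"
  have "prod_decode (?init 0) = (m, g)"
    by simp
  then obtain r where "r 0 = m" "r 1 = g" "r 2 = m"
      "\<And>res. runs os (check_components k n) r res \<Longrightarrow> runs os (enumerator n k) ?init res"
    using runs_enumerator(1)[of os R ?init m g k n] assms m by fastforce
  then obtain r' where "runs os (enumerator n k) ?init (Some r')" "r' 0 = m"
    using g[of r] by metis
  then have "computes os (enumerator n k 0) ?x m"
    using runs_Some_computes_iff by blast
  then show "m \<in> {y. \<exists>x. computes os (enumerator n k 0) x y}"
    by blast
next
  fix y assume "y \<in> {y. \<exists>x. computes os (enumerator n k 0) x y}"
  then obtain x where x: "computes os (enumerator n k 0) x y"
    by blast
  let ?init = "(\<lambda>_ :: nat. 0)(0 := x)"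
  obtain m g where "prod_decode (?init 0) = (m, g)"
    by fastforce
  note runs = runs_enumerator[where r = ?init, OF _ assms(3) this, where k = k and n = n]
  have "m \<in> R"
    using runs(2) runs_None_not_computes[of os "enumerator n k" x y] x assms(2) by fastforce
  then obtain r where r: "r 0 = m" "r 2 = m"
      "\<And>res. runs os (check_components k n) r res \<Longrightarrow> runs os (enumerator n k) ?init res"
    using runs(1) assms(2) by fastforce
  \<comment> \<open>The machine halts on \<open>x\<close>, so the component tests cannot
    diverge.\<close>
  have "\<not> runs os (check_components k n) r None"
    using r(3) runs_None_not_computes x by blast
  then obtain r' where r': "runs os (check_components k n) r (Some r')" "r' 0 = m"
      "\<forall>i\<in>{1..n}. i \<le> k \<longrightarrow> code_proj n i m \<in> range (os ! i)"
    using runs_check_components_sound[OF assms(2), of n r] r by auto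
  have "y = m"
    using runs_Some_computes_iff[OF r(3)[OF r'(1)]] x r'(2) by simp
  then show "y \<in> {m \<in> R. \<forall>i\<in>{1..k}. code_proj n i m \<in> range (os ! i)}"
    using r'(3) \<open>m \<in> R\<close> assms(1) by auto
qed

section \<open>The basic representation\<close>

text \<open>A product of sets determines its factors only if it is nonempty, which the point
  \<open>s\<close> guarantees. An empty product may have a code whose components code sets outside
  the bases \<open>B i\<close>.\<close>

lemma code_dom_prod_codingD:
  assumes "r \<in> code_dom (prod_basis n B) (prod_coding n \<nu>)" "s \<in> the (prod_coding n \<nu> r)"
    and "i \<in> {1..n}"
  shows "code_proj n i r \<in> code_dom (B i) (\<nu> i)"
proof -
  let ?V = "\<lambda>i. the (\<nu> i (code_proj n i r))"
  obtain U where U: "\<forall>i\<in>{1..n}. U i \<in> B i" "prod_coding n \<nu> r = Some (Pi\<^sub>E {1..n} U)"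
    using assms(1) by (auto simp: code_dom_def prod_basis_def)
  then have nu: "\<forall>i\<in>{1..n}. \<nu> i (code_proj n i r) \<noteq> None"
    and eq: "Pi\<^sub>E {1..n} ?V = Pi\<^sub>E {1..n} U"
    by (auto simp: prod_coding_def split: if_splits)
  have "Pi\<^sub>E {1..n} U \<noteq> {}"
    using assms(2) U(2) by auto
  then have "?V i = U i"
    using eq assms(3) unfolding PiE_eq_iff PiE_eq_empty_iff by blast
  then show ?thesis
    using U(1) nu assms(3) by (force simp: code_dom_def)
qed

lemma the_prod_coding:
  assumes "r \<in> code_dom (prod_basis n B) (prod_coding n \<nu>)"
  shows "the (prod_coding n \<nu> r) = Pi\<^sub>E {1..n} (\<lambda>i. the (\<nu> i (code_proj n i r)))"
  using assms by (auto simp: code_dom_def prod_coding_def split: if_splits)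

lemma T1_basis_separates:
  assumes "T1_effective_topology X B \<nu>" "x \<in> X" "y \<in> X" "x \<noteq> y"
  obtains U where "U \<in> B" "x \<in> U" "y \<notin> U"
proof -
  obtain T where T: "topspace T = X" "basis_of T B" "t1_space T"
    using assms(1) unfolding T1_effective_topology_def by blast
  obtain W where "openin T W" "x \<in> W" "y \<notin> W"
    using T assms unfolding t1_space_def by blast
  then have "(arbitrary union_of (\<lambda>U. U \<in> B)) W"
    using T(2) by (simp add: basis_of_def)
  then obtain U where "U \<in> B" "x \<in> U" "U \<subseteq> W"
    using \<open>x \<in> W\<close> unfolding arbitrary_union_of_alt by blast
  then show thesis
    using that \<open>y \<notin> W\<close> by blast
qed

lemma oracle_forD:
  assumes "oracle_for B \<nu> x \<phi>" "m \<in> range \<phi>"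
  shows "x \<in> the (\<nu> m)" "the (\<nu> m) \<in> B"
  using assms by (auto simp: oracle_for_def local_basis_def)

lemma effective_topology_subset:
  assumes "effective_topology X B \<nu>" "U \<in> B"
  shows "U \<subseteq> X"
proof -
  obtain T where T: "topspace T = X" "basis_of T B"
    using assms(1) unfolding effective_topology_def by blast
  have "(arbitrary union_of (\<lambda>U. U \<in> B)) U"
    using assms(2) unfolding arbitrary_union_of_alt by blast
  then have "openin T U"
    using T(2) by (simp add: basis_of_def)
  then show ?thesis
    using T(1) openin_subset by blast
qed

section \<open>Fixing the first \<open>k\<close> coordinates\<close>

lemma basic_representation_section:
  fixes X :: "nat \<Rightarrow> 'a set" and \<phi> :: "nat \<Rightarrow> nat \<Rightarrow> nat"
  assumes "k \<le> n"
    and top: "\<And>i. i \<in> {1..n} \<Longrightarrow> effective_topology (X i) (B i) (\<nu> i)"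
    and T1: "T1_effective_topology (Pi\<^sub>E {1..n} X) (prod_basis n B) (prod_coding n \<nu>)"
    and rep: "basic_representation (Pi\<^sub>E {1..n} X) (prod_basis n B) (prod_coding n \<nu>) R S"
    and compl: "\<And>i. i \<in> {1..k} \<Longrightarrow> complete_oracle_for (B i) (\<nu> i) (x i) (\<phi> i)"
  shows "basic_representation (Pi\<^sub>E {1..n} X) (prod_basis n B) (prod_coding n \<nu>)
           {r \<in> R. \<forall>i\<in>{1..k}. code_proj n i r \<in> range (\<phi> i)} {s \<in> S. \<forall>i\<in>{1..k}. s i = x i}"
    (is "basic_representation ?X ?B ?\<nu> ?Q ?P")
proof -
  have R: "R \<subseteq> code_dom ?B ?\<nu>" and S: "S \<subseteq> ?X"
    and S_iff: "\<And>s. s \<in> ?X \<Longrightarrow>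
      s \<in> S \<longleftrightarrow> (\<exists>L. local_basis ?B s L \<and> L \<subseteq> (\<lambda>r. the (?\<nu> r)) ` R)"
    using rep unfolding basic_representation_def by auto
  have local_basis: "\<exists>L. local_basis ?B s L \<and> L \<subseteq> (\<lambda>r. the (?\<nu> r)) ` ?Q" if s: "s \<in> ?P" for s
  proof -
    obtain L where L: "local_basis ?B s L" "L \<subseteq> (\<lambda>r. the (?\<nu> r)) ` R"
      using s S S_iff[of s] by blast
    \<comment> \<open>The local basis that \<open>R\<close> provides for \<open>s\<close> is kept;
      each code in \<open>R\<close> of one of its members is shown to lie in
      \<open>?Q\<close>.\<close>
    have "L \<subseteq> (\<lambda>r. the (?\<nu> r)) ` ?Q"
    proof
      fix U assume "U \<in> L"
      then obtain r where r: "r \<in> R" "U = the (?\<nu> r)" and "s \<in> U"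
        using L by (auto simp: local_basis_def)
      have "code_proj n i r \<in> range (\<phi> i)" if i: "i \<in> {1..k}" for i
      proof -
        have "i \<in> {1..n}"
          using i assms(1) by simp
        moreover have "r \<in> code_dom ?B ?\<nu>"
          using r R by blast
        ultimately have "code_proj n i r \<in> code_dom (B i) (\<nu> i)"
            "s i \<in> the (\<nu> i (code_proj n i r))"
          using code_dom_prod_codingD[of r n B \<nu> s i] the_prod_coding[of r n B \<nu>] r \<open>s \<in> U\<close>
          by (auto dest: PiE_mem)
        moreover have "s i = x i"
          using s i by blast
        ultimately show ?thesis
          using compl[OF i] by (auto simp: complete_oracle_for_def)
      qed
      then show "U \<in> (\<lambda>r. the (?\<nu> r)) ` ?Q"
        using r by blast
    qed
    then show ?thesis
      using L(1) by blast
  qed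
  have in_P: "s \<in> ?P"
    if s: "s \<in> ?X" and L: "local_basis ?B s L" "L \<subseteq> (\<lambda>r. the (?\<nu> r)) ` ?Q" for s L
  proof -
    have "s i = x i" if i: "i \<in> {1..k}" for i
    proof (rule ccontr)
      assume neq: "s i \<noteq> x i"
      let ?s = "s(i := x i)"
      have in_n: "i \<in> {1..n}"
        using i assms(1) by simp
      have orc: "oracle_for (B i) (\<nu> i) (x i) (\<phi> i)"
        using compl[OF i] by (simp add: complete_oracle_for_def)
      \<comment> \<open>That \<open>x i\<close> lies in \<open>X i\<close> comes from the oracle:
        \<open>x i\<close> belongs to the basis set coded by the oracle's value at 0.\<close>
      have "x i \<in> X i"
        using oracle_forD[OF orc, of "\<phi> i 0"] effective_topology_subset[OF top[OF in_n]] by blast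
      then have "?s \<in> ?X"
        using s in_n by (auto simp: PiE_iff extensional_def)
      moreover have "s \<noteq> ?s"
        using neq by (metis fun_upd_same)
      ultimately obtain U where "U \<in> ?B" "s \<in> U" "?s \<notin> U"
        using T1_basis_separates[OF T1 s] by blast
      then obtain V where V: "V \<in> L" "s \<in> V" "?s \<notin> V"
        using L(1) unfolding local_basis_def by blast
      then obtain r where r: "r \<in> ?Q" "V = the (?\<nu> r)"
        using L(2) by blast
      \<comment> \<open>As \<open>r\<close> is in \<open>?Q\<close>, its component \<open>i\<close>
        is an oracle value and so codes a neighbourhood of \<open>x i\<close>; hence
        \<open>V\<close> cannot exclude \<open>?s\<close>.\<close>
      have "x i \<in> the (\<nu> i (code_proj n i r))"
        using r i by (intro oracle_forD[OF orc]) blast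
      moreover have "V = Pi\<^sub>E {1..n} (\<lambda>i. the (\<nu> i (code_proj n i r)))"
        using the_prod_coding[of r n B \<nu>] r R by auto
      ultimately have "?s \<in> V"
        using \<open>s \<in> V\<close> in_n by (auto simp: PiE_iff extensional_def)
      then show False
        using V by blast
    qed
    moreover have "L \<subseteq> (\<lambda>r. the (?\<nu> r)) ` R"
      using L(2) by blast
    ultimately show ?thesis
      using S_iff[OF s] L(1) by blast
  qed
  show ?thesis
    unfolding basic_representation_def
  proof (intro conjI ballI iffI)
    fix s assume "s \<in> ?X" "\<exists>L. local_basis ?B s L \<and> L \<subseteq> (\<lambda>r. the (?\<nu> r)) ` ?Q"
    then show "s \<in> ?P"
      by (elim exE conjE) (rule in_P)
  next
    fix s assume "s \<in> ?P"
    then show "\<exists>L. local_basis ?B s L \<and> L \<subseteq> (\<lambda>r. the (?\<nu> r)) ` ?Q"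
      by (rule local_basis)
  qed (use S R in auto)
qed

lemma oracle_list_nth:
  shows "oracle_list R k \<phi> ! 0 = (\<lambda>m. of_bool (m \<in> R))"
    and "i \<in> {1..k} \<Longrightarrow> oracle_list R k \<phi> ! i = \<phi> i"
    and "length (oracle_list R k \<phi>) = Suc k"
  by (auto simp: oracle_list_def nth_Cons' nth_map_upt[of "i - 1" "Suc k" 1] simp del: upt_Suc)

theorem theorem13:
  fixes n k :: nat
    and X :: "nat \<Rightarrow> real set"
    and B :: "nat \<Rightarrow> real set set"
    and \<nu> :: "nat \<Rightarrow> real coding"
  assumes "1 \<le> n" and "k \<le> n"
    and "\<And>i. i \<in> {1..n} \<Longrightarrow> effective_topology (X i) (B i) (\<nu> i)"
    and "T1_effective_topology (Pi\<^sub>E {1..n} X) (prod_basis n B) (prod_coding n \<nu>)"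
  shows "\<exists>M :: machine. \<forall>S A R H x \<phi>.
    normal_form n (S, A) \<longrightarrow>
    (\<forall>i\<in>{1..n}. cart_proj i ` S \<subseteq> X i) \<longrightarrow>
    basic_representation_model n X B \<nu> (R, H) (S, A) \<longrightarrow>
    (\<forall>i\<in>{1..k}. complete_oracle_for (B i) (\<nu> i) (x i) (\<phi> i)) \<longrightarrow>
    (\<exists>Q. basic_representation (Pi\<^sub>E {1..n} X) (prod_basis n B) (prod_coding n \<nu>) Q
           {s \<in> S. \<forall>i\<in>{1..k}. cart_proj i s = x i} \<and>
         enumerates (oracle_list R k \<phi>) M Q)"
\<comment> \<open>The machine depends on \<open>n\<close> and \<open>k\<close> alone and is fixed
  before the states, representations, points and oracles; this is the uniformity.\<close>
proof (rule exI[of _ "enumerator n k 0"], intro allI impI)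
  fix S A R H x and \<phi> :: "nat \<Rightarrow> nat \<Rightarrow> nat"
  let ?Q = "{r \<in> R. \<forall>i\<in>{1..k}. code_proj n i r \<in> range (\<phi> i)}"
  assume "basic_representation_model n X B \<nu> (R, H) (S, A)"
    and "\<forall>i\<in>{1..k}. complete_oracle_for (B i) (\<nu> i) (x i) (\<phi> i)"
  then have "basic_representation (Pi\<^sub>E {1..n} X) (prod_basis n B) (prod_coding n \<nu>) ?Q
      {s \<in> S. \<forall>i\<in>{1..k}. s i = x i}"
    by (intro basic_representation_section[OF assms(2,3,4)])
      (auto simp: basic_representation_model_def)
  moreover have "enumerates (oracle_list R k \<phi>) (enumerator n k 0) ?Q"
    using enumerates_enumerator[OF assms(2), of "oracle_list R k \<phi>" R]
    by (simp add: oracle_list_nth)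
  ultimately show "\<exists>Q. basic_representation (Pi\<^sub>E {1..n} X) (prod_basis n B) (prod_coding n \<nu>) Q
      {s \<in> S. \<forall>i\<in>{1..k}. cart_proj i s = x i} \<and>
      enumerates (oracle_list R k \<phi>) (enumerator n k 0) Q"
    unfolding cart_proj_def by blast
qed

end
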